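(* Let $n\ge 1$ and let \[ \lambda=(L_1^{m_1},L_2^{m_2},\dots,L_r^{m_r})\vdash n,\qquad L_1>\cdots>L_r>0,\qquad L_{r+1}=0, \] and let $g_i:=L_i-L_{i+1}$ for $1\le i\le r$. Then \[ n=T_r+\sum_{j=1}^r j(g_j-1)+\sum_{i=1}^r (m_i-1)L_i, \] where $T_r=\frac{r(r+1)}{2}$.
   Context: The notation $\lambda=(L_1^{m_1},\dots,L_r^{m_r})\vdash n$ with $L_1>\cdots>L_r>0$ means that $\lambda$ is the partition of $n$ whose distinct part sizes are exactly the positive integers $L_1,\dots,L_r$, where $L_i$ occurs with multiplicity $m_i\ge 1$; thus $n=\sum_{i=1}^r m_iL_i$. The convention $L_{r+1}:=0$ is used, so $g_r=L_r$. *)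

theory Defs
  imports Main "HOL-Library.Multiset"
begin

definition is_partition :: "nat multiset \<Rightarrow> nat \<Rightarrow> bool" where
  "is_partition lam n \<longleftrightarrow> 0 \<notin># lam \<and> sum_mset lam = n"

text \<open>
  Multiplicity notation \<open>lam = (L\<^sub>1^m\<^sub>1, ..., L\<^sub>r^m\<^sub>r)\<close> with \<open>L\<^sub>1 > ... > L\<^sub>r > 0\<close>. Indices start at 1;
  the values of \<open>L\<close> and \<open>m\<close> outside \<open>{1..r}\<close> are unconstrained here.
\<close>

definition has_mult_form ::
    "nat multiset \<Rightarrow> nat \<Rightarrow> (nat \<Rightarrow> nat) \<Rightarrow> (nat \<Rightarrow> nat) \<Rightarrow> bool" where
  "has_mult_form lam r L m \<longleftrightarrow>
     (\<forall>i\<in>{1..r}. L i > 0) \<and>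
     (\<forall>i\<in>{1..<r}. L i > L (i + 1)) \<and>
     set_mset lam = L ` {1..r} \<and>
     (\<forall>i\<in>{1..r}. m i \<ge> 1 \<and> count lam (L i) = m i)"

text \<open>The division is exact.\<close>

definition triangular :: "nat \<Rightarrow> nat" where
  "triangular r = r * (r + 1) div 2"

end

theory Submission
  imports Defs
begin

text \<open>
  Grouping the parts of \<open>\<lambda>\<close> by size gives \<open>n = \<Sum>\<^sub>i m\<^sub>i L\<^sub>i\<close>, that is,
  \<open>n = \<Sum>\<^sub>i L\<^sub>i + \<Sum>\<^sub>i (m\<^sub>i - 1) L\<^sub>i\<close> (lemma \<open>sum_mset_mult_form\<close>). Since \<open>L\<^bsub>r+1\<^esub> = 0\<close>, summation
  by parts turns the first sum into \<open>\<Sum>\<^sub>j j g\<^sub>j\<close> (lemma \<open>sum_mult_diff_Suc\<close>), and splitting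
  \<open>g\<^sub>j = 1 + (g\<^sub>j - 1)\<close> extracts the triangular number \<open>1 + \<dots> + r\<close>.
\<close>

lemma int_triangular: "int (triangular r) = (\<Sum>j=1..r. int j)"
proof -
  have "triangular r = (\<Sum>j=1..r. j)"
    using gauss_sum_from_Suc_0[where ?'a = nat, of r] by (simp add: triangular_def)
  then show ?thesis by simp
qed

lemma sum_mult_diff_Suc:
  fixes f :: "nat \<Rightarrow> 'a::comm_ring_1"
  shows "(\<Sum>j=1..r. of_nat j * (f j - f (Suc j))) = (\<Sum>j=1..r. f j) - of_nat r * f (Suc r)"
  by (induction r) (simp_all add: algebra_simps)

lemma sum_mset_eq_sum_count:
  fixes M :: "'a::semiring_1 multiset"
  shows "sum_mset M = (\<Sum>x\<in>set_mset M. of_nat (count M x) * x)"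
proof (induction M)
  case (add y M)
  have "(\<Sum>x\<in>set_mset (add_mset y M). of_nat (count (add_mset y M) x) * x)
      = (\<Sum>x\<in>insert y (set_mset M). of_nat (count M x) * x + (if x = y then y else 0))"
    by (intro sum.cong) (auto simp: algebra_simps)
  also have "\<dots> = (\<Sum>x\<in>insert y (set_mset M). of_nat (count M x) * x) + y"
    by (simp only: sum.distrib) simp
  also have "(\<Sum>x\<in>insert y (set_mset M). of_nat (count M x) * x) = (\<Sum>x\<in>set_mset M. of_nat (count M x) * x)"
    by (intro sum.mono_neutral_right) (auto simp: not_in_iff)
  finally show ?case using add by (simp add: add.commute)
qed simp

lemma has_mult_form_inj_on:
  assumes "has_mult_form lam r L m"
  shows "inj_on L {1..r}"
proof -
  have less: "L j < L i" if "i < j" "1 \<le> i" "j \<le> r" for i j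
    using that
  proof (induction j rule: less_Suc_induct)
    case (1 k)
    then show ?case using assms by (auto simp: has_mult_form_def)
  next
    case (2 i j k)
    then show ?case by fastforce
  qed
  then show ?thesis
    by (intro linorder_inj_onI) fastforce+
qed

lemma sum_mset_mult_form:
  assumes "has_mult_form lam r L m"
  shows "sum_mset lam = (\<Sum>i=1..r. m i * L i)"
proof -
  have "sum_mset lam = (\<Sum>x\<in>L ` {1..r}. count lam x * x)"
    using assms by (simp add: has_mult_form_def sum_mset_eq_sum_count)
  also have "\<dots> = (\<Sum>i=1..r. count lam (L i) * L i)"
    by (subst sum.reindex[OF has_mult_form_inj_on[OF assms]]) simp
  also have "\<dots> = (\<Sum>i=1..r. m i * L i)"
    using assms by (intro sum.cong) (auto simp: has_mult_form_def)
  finally show ?thesis .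
qed

theorem lemma3p1:
  fixes n r :: nat and lam :: "nat multiset" and L m :: "nat \<Rightarrow> nat" and g :: "nat \<Rightarrow> int"
  assumes "n \<ge> 1"
    and "is_partition lam n"
    and "has_mult_form lam r L m"
    and "L (r + 1) = 0"
    and "\<And>i. i \<in> {1..r} \<Longrightarrow> g i = int (L i) - int (L (i + 1))"
  shows "int n = int (triangular r) + (\<Sum>j=1..r. int j * (g j - 1))
           + (\<Sum>i=1..r. (int (m i) - 1) * int (L i))"
proof -
  have "(\<Sum>j=1..r. int j * g j) = (\<Sum>j=1..r. int j * (int (L j) - int (L (Suc j))))"
    using assms(5) by (intro sum.cong) auto
  also have "\<dots> = (\<Sum>j=1..r. int (L j))"
    using sum_mult_diff_Suc[of "\<lambda>j. int (L j)" r] assms(4) by simp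
  finally have parts: "(\<Sum>j=1..r. int j * g j) = (\<Sum>j=1..r. int (L j))" .
  have "n = (\<Sum>i=1..r. m i * L i)"
    using assms(2) sum_mset_mult_form[OF assms(3)] by (simp add: is_partition_def)
  then have "int n = (\<Sum>i=1..r. int (m i) * int (L i))"
    by simp
  then show ?thesis
    using parts by (simp add: int_triangular algebra_simps sum.distrib sum_subtractf)
qed

end
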